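(* Let $(X,d)$ be a complete CAT(0) space. Let $(T_\gamma)_{\gamma>0}$ be a jointly $(P_2)$ family of self-mappings of $X$. Put $F:=\bigcap_{\gamma>0}\mathrm{Fix}(T_\gamma)$. Let $x\in X$, $b>0$, and $(\lambda_n)_{n\in\mathbb{N}}\subseteq(0,\infty)$ with $\lim_{n\to\infty}\lambda_n=\infty$, and assume that for all $n\in\mathbb{N}$, $d(x,T_{\lambda_n}x)\le b$. Then $F\ne\emptyset$, and the curve $(T_\gamma x)_{\gamma>0}$ (i.e. the map $\gamma\mapsto T_\gamma x$ from $(0,\infty)$ to $X$) is continuous and converges, as $\gamma\to\infty$, to the unique point in $F$ which is closest to $x$.
   Context: A metric space $(X,d)$ is geodesic if for any $x,y\in X$ there is a geodesic joining them, i.e. a map $\gamma:[0,1]\to X$ with $\gamma(0)=x$, $\gamma(1)=y$ and $d(\gamma(t),\gamma(t'))=|t-t'|d(x,y)$ for all $t,t'\in[0,1]$. A CAT(0) space is a geodesic space $(X,d)$ such that for any geodesic $\gamma:[0,1]\to X$, any $z\in X$ and any $t\in[0,1]$, $d^2(z,\gamma(t))\le(1-t)d^2(z,\gamma(0))+td^2(z,\gamma(1))-t(1-t)d^2(\gamma(0),\gamma(1))$. (Here $d^2(x,y)$ means $(d(x,y))^2$.) $\mathrm{Fix}(T)$ denotes the set of fixed points of a self-mapping $T$. For self-mappings $T,U$ of $X$ and $\lambda,\mu>0$, $T$ and $U$ are $(\lambda,\mu)$-mutually $(P_2)$ if for all $x,y\in X$, $$\frac1\mu\big(d^2(Tx,Uy)+d^2(y,Uy)-d^2(y,Tx)\big)\le\frac1\lambda\big(d^2(x,Uy)-d^2(x,Tx)-d^2(Tx,Uy)\big).$$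 A family $(T_\gamma)_{\gamma>0}$ of self-mappings of $X$ is jointly $(P_2)$ if for all $\lambda,\mu>0$, $T_\lambda$ and $T_\mu$ are $(\lambda,\mu)$-mutually $(P_2)$. *)

theory Defs
  imports "HOL-Analysis.Analysis"
begin

(* Only the restriction of c to [0, 1] matters; its values elsewhere are unconstrained. *)
definition (in metric_space) geodesic :: "(real \<Rightarrow> 'a) \<Rightarrow> 'a \<Rightarrow> 'a \<Rightarrow> bool" where
  "geodesic c x y \<longleftrightarrow> c 0 = x \<and> c 1 = y \<and>
     (\<forall>s\<in>{0..1}. \<forall>t\<in>{0..1}. dist (c s) (c t) = \<bar>s - t\<bar> * dist x y)"

class geodesic_space = metric_space +
  assumes geodesic_exists: "\<exists>c. geodesic c x y"

class cat0_space = geodesic_space +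
  assumes cat0_ineq:
    "geodesic c x y \<Longrightarrow> 0 \<le> t \<Longrightarrow> t \<le> 1 \<Longrightarrow>
      (dist z (c t))\<^sup>2 \<le> (1 - t) * (dist z x)\<^sup>2 + t * (dist z y)\<^sup>2 - t * (1 - t) * (dist x y)\<^sup>2"

definition Fix :: "('a \<Rightarrow> 'a) \<Rightarrow> 'a set" where
  "Fix T = {x. T x = x}"

definition mutually_P2 ::
  "real \<Rightarrow> real \<Rightarrow> ('a::metric_space \<Rightarrow> 'a) \<Rightarrow> ('a \<Rightarrow> 'a) \<Rightarrow> bool" where
  "mutually_P2 l m T U \<longleftrightarrow>
     (\<forall>x y. 1 / m * ((dist (T x) (U y))\<^sup>2 + (dist y (U y))\<^sup>2 - (dist y (T x))\<^sup>2)
          \<le> 1 / l * ((dist x (U y))\<^sup>2 - (dist x (T x))\<^sup>2 - (dist (T x) (U y))\<^sup>2))"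

(* Families indexed by the positive reals are total functions on the reals that are
   used at positive arguments only. *)
definition jointly_P2 :: "(real \<Rightarrow> 'a::metric_space \<Rightarrow> 'a) \<Rightarrow> bool" where
  "jointly_P2 T \<longleftrightarrow> (\<forall>l>0. \<forall>m>0. mutually_P2 l m (T l) (T m))"

definition common_Fix :: "(real \<Rightarrow> 'a \<Rightarrow> 'a) \<Rightarrow> 'a set" where
  "common_Fix T = (\<Inter>g\<in>{0<..}. Fix (T g))"

definition closest_points :: "'a::metric_space \<Rightarrow> 'a set \<Rightarrow> 'a set" where
  "closest_points x F = {p \<in> F. \<forall>q\<in>F. dist x p \<le> dist x q}"

end

theory Submission
  imports Defs
begin

text \<open>
  Applying the mutual condition to \<open>T\<^sub>\<lambda>\<close>, \<open>T\<^sub>\<mu>\<close> at one and the same point \<open>x\<close> gives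
  \<open>(\<mu> + \<lambda>) d\<^sup>2(T\<^sub>\<lambda>x, T\<^sub>\<mu>x) \<le> (\<mu> - \<lambda>) (d\<^sup>2(x, T\<^sub>\<mu>x) - d\<^sup>2(x, T\<^sub>\<lambda>x))\<close>.
  Hence \<open>\<lambda> \<mapsto> d(x, T\<^sub>\<lambda>x)\<close> is nondecreasing, and so bounded by \<open>b\<close>; the same inequality then
  yields continuity of the curve and, since \<open>d\<^sup>2(x, T\<^sub>\<lambda>x)\<close> converges, its Cauchy property at infinity.
  Letting \<open>\<lambda> \<rightarrow> \<infinity>\<close> in the mutual condition at \<open>x\<close> and the limit \<open>p\<close> shows that \<open>p\<close> is a common
  fixed point; at \<open>x\<close> and an arbitrary common fixed point \<open>q\<close> it gives
  \<open>d\<^sup>2(p, q) + d\<^sup>2(x, p) \<le> d\<^sup>2(x, q)\<close>.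
\<close>

lemma jointly_P2_D:
  assumes "jointly_P2 T" "0 < l" "0 < m"
  shows "1 / m * ((dist (T l x) (T m y))\<^sup>2 + (dist y (T m y))\<^sup>2 - (dist y (T l x))\<^sup>2)
    \<le> 1 / l * ((dist x (T m y))\<^sup>2 - (dist x (T l x))\<^sup>2 - (dist (T l x) (T m y))\<^sup>2)"
  using assms unfolding jointly_P2_def mutually_P2_def by blast

lemma jointly_P2_same_point:
  assumes "jointly_P2 T" "0 < l" "0 < m"
  shows "(m + l) * (dist (T l x) (T m x))\<^sup>2
    \<le> (m - l) * ((dist x (T m x))\<^sup>2 - (dist x (T l x))\<^sup>2)"
proof -
  have "l * ((dist (T l x) (T m x))\<^sup>2 + (dist x (T m x))\<^sup>2 - (dist x (T l x))\<^sup>2)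
    \<le> m * ((dist x (T m x))\<^sup>2 - (dist x (T l x))\<^sup>2 - (dist (T l x) (T m x))\<^sup>2)"
    using jointly_P2_D[OF assms, of x x] assms(2,3) by (simp add: field_simps)
  then show ?thesis
    by (simp add: algebra_simps)
qed

text \<open>For \<open>l < m\<close> the left side of \<open>jointly_P2_same_point\<close> is
  nonnegative and the factor \<open>m - l\<close> is positive, so the difference of squares cannot
  be negative.\<close>

lemma jointly_P2_mono:
  assumes "jointly_P2 T" "0 < l" "l \<le> m"
  shows "dist x (T l x) \<le> dist x (T m x)"
proof (cases "l = m")
  case False
  then have "0 < m" "0 < m - l"
    using assms by auto
  moreover have "0 \<le> (m + l) * (dist (T l x) (T m x))\<^sup>2"
    using assms by simp
  ultimately have "0 \<le> (dist x (T m x))\<^sup>2 - (dist x (T l x))\<^sup>2"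
    using jointly_P2_same_point[OF assms(1,2), of m x] by (meson order_trans zero_le_mult_iff not_less)
  then show ?thesis
    by (simp add: abs_le_square_iff)
qed simp

text \<open>Extends the bound from the given parameters to all positive ones: each \<open>g\<close>
  eventually lies below \<open>l n\<close>, and monotonicity applies.\<close>

lemma jointly_P2_bounded:
  assumes "jointly_P2 T" "filterlim l at_top F" "F \<noteq> bot"
    and "\<forall>\<^sub>F n in F. dist x (T (l n) x) \<le> b" and "0 < g"
  shows "dist x (T g x) \<le> b"
proof -
  have "\<forall>\<^sub>F n in F. g \<le> l n"
    using assms(2) by (simp add: filterlim_at_top)
  with assms(4) have "\<forall>\<^sub>F n in F. dist x (T g x) \<le> b"
    by eventually_elim (use jointly_P2_mono[OF assms(1,5)] order_trans in blast)
  with assms(3) show ?thesis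
    by simp
qed

text \<open>By monotonicity the difference of squares is nonnegative, so its factor
  \<open>m - l\<close> may be enlarged to \<open>m + l\<close> and cancelled. This form serves the
  Cauchy estimate.\<close>

lemma jointly_P2_dist_le:
  assumes "jointly_P2 T" "0 < l" "l \<le> m"
  shows "(dist (T l x) (T m x))\<^sup>2 \<le> (dist x (T m x))\<^sup>2 - (dist x (T l x))\<^sup>2"
proof -
  let ?D = "(dist x (T m x))\<^sup>2 - (dist x (T l x))\<^sup>2"
  have "0 \<le> ?D"
    using jointly_P2_mono[OF assms] by (simp add: power_mono)
  then have "(m - l) * ?D \<le> (m + l) * ?D"
    using assms by (intro mult_right_mono) auto
  then have "(m + l) * (dist (T l x) (T m x))\<^sup>2 \<le> (m + l) * ?D"
    using jointly_P2_same_point[OF assms(1,2), of m x] assms by linarith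
  then show ?thesis
    using assms by simp
qed

lemma jointly_P2_continuous:
  assumes "jointly_P2 T" and bound: "\<And>g. 0 < g \<Longrightarrow> dist x (T g x) \<le> b"
  shows "continuous_on {0<..} (\<lambda>g. T g x)"
  unfolding continuous_on_def
proof
  fix g :: real
  assume "g \<in> {0<..}"
  then have g: "0 < g" by simp
  have le: "(dist (T h x) (T g x))\<^sup>2 \<le> \<bar>h - g\<bar> / g * b\<^sup>2" if h: "0 < h" for h
  proof -
    let ?D = "(dist x (T h x))\<^sup>2 - (dist x (T g x))\<^sup>2"
    have "(dist x (T h x))\<^sup>2 \<le> b\<^sup>2" "(dist x (T g x))\<^sup>2 \<le> b\<^sup>2"
      using bound g h by (simp_all add: power_mono)
    then have "\<bar>?D\<bar> \<le> b\<^sup>2"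
      using zero_le_power2[of "dist x (T h x)"] zero_le_power2[of "dist x (T g x)"] by linarith
    \<comment> \<open>Weakening \<open>h + g\<close> to \<open>g\<close> keeps the final denominator
      independent of the moving parameter \<open>h\<close>.\<close>
    have "g * (dist (T g x) (T h x))\<^sup>2 \<le> (h + g) * (dist (T g x) (T h x))\<^sup>2"
      using h by (intro mult_right_mono) auto
    also have "\<dots> \<le> (h - g) * ?D"
      by (rule jointly_P2_same_point[OF assms(1) g h])
    also have "\<dots> \<le> \<bar>h - g\<bar> * \<bar>?D\<bar>"
      by (simp flip: abs_mult)
    also have "\<dots> \<le> \<bar>h - g\<bar> * b\<^sup>2"
      using \<open>\<bar>?D\<bar> \<le> b\<^sup>2\<close> by (intro mult_left_mono) auto
    finally show ?thesis
      using g by (simp add: field_simps dist_commute)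
  qed
  have "((\<lambda>h. \<bar>h - g\<bar> / g * b\<^sup>2) \<longlongrightarrow> \<bar>g - g\<bar> / g * b\<^sup>2) (at g within {0<..})"
    using g by (intro tendsto_intros) simp
  then have "((\<lambda>h. \<bar>h - g\<bar> / g * b\<^sup>2) \<longlongrightarrow> 0) (at g within {0<..})"
    by simp
  then have "((\<lambda>h. (dist (T h x) (T g x))\<^sup>2) \<longlongrightarrow> 0) (at g within {0<..})"
    by (rule tendsto_sandwich[OF _ _ tendsto_const, rotated 2])
      (simp_all add: eventually_at_filter always_eventually le[simplified])
  then have "((\<lambda>h. sqrt ((dist (T h x) (T g x))\<^sup>2)) \<longlongrightarrow> sqrt 0) (at g within {0<..})"
    by (rule tendsto_real_sqrt)
  then show "((\<lambda>h. T h x) \<longlongrightarrow> T g x) (at g within {0<..})"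
    by (simp add: tendsto_dist_iff[of _ "T g x"])
qed

text \<open>The squared distances from \<open>x\<close> are monotone and bounded in the parameter,
  hence nearly constant on tails, and \<open>jointly_P2_dist_le\<close> turns this into closeness of
  the points of the curve.\<close>

lemma jointly_P2_convergent:
  fixes T :: "real \<Rightarrow> 'a \<Rightarrow> 'a::complete_space"
  assumes "jointly_P2 T" and bound: "\<And>g. 0 < g \<Longrightarrow> dist x (T g x) \<le> b"
  obtains p where "((\<lambda>g. T g x) \<longlongrightarrow> p) at_top"
proof -
  define S where "S = (\<lambda>g. (dist x (T g x))\<^sup>2) ` {0<..}"
  have bdd: "bdd_above S"
    unfolding S_def using bound by (intro bdd_aboveI2[where M = "b\<^sup>2"]) (simp add: power_mono)
  have ne: "S \<noteq> {}"
    by (auto simp: S_def)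
  have tail: "\<exists>k>0. \<forall>g\<ge>k. \<forall>h\<ge>k. dist (T g x) (T h x) < e" if "0 < e" for e
  proof -
    \<comment> \<open>The tolerance is \<open>e\<^sup>2\<close> because the distance estimate
      compares squares.\<close>
    have "Sup S - e\<^sup>2 < Sup S"
      using that by simp
    then obtain s where s: "s \<in> S" "Sup S - e\<^sup>2 < s"
      using less_cSupD[OF ne] by blast
    then obtain k where k: "0 < k" "Sup S - e\<^sup>2 < (dist x (T k x))\<^sup>2"
      by (auto simp: S_def)
    have ord: "dist (T g x) (T h x) < e" if "k \<le> g" "g \<le> h" for g h
    proof -
      have "0 < g" "0 < h"
        using k that by auto
      have "(dist x (T k x))\<^sup>2 \<le> (dist x (T g x))\<^sup>2"
        using jointly_P2_mono[OF assms(1) k(1) that(1)] by (simp add: power_mono)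
      moreover have "(dist x (T h x))\<^sup>2 \<le> Sup S"
        using \<open>0 < h\<close> bdd by (intro cSup_upper) (auto simp: S_def)
      moreover have "(dist (T g x) (T h x))\<^sup>2 \<le> (dist x (T h x))\<^sup>2 - (dist x (T g x))\<^sup>2"
        by (rule jointly_P2_dist_le[OF assms(1) \<open>0 < g\<close> that(2)])
      ultimately have "(dist (T g x) (T h x))\<^sup>2 < e\<^sup>2"
        using k(2) by linarith
      then show ?thesis
        using \<open>0 < e\<close> by (simp add: power_less_imp_less_base)
    qed
    have "dist (T g x) (T h x) < e" if "k \<le> g" "k \<le> h" for g h
      using ord[of g h] ord[of h g] that by (cases "g \<le> h") (simp_all add: dist_commute)
    with k(1) show ?thesis
      by blast
  qed
  \<comment> \<open>The parameter is real, so completeness enters through Cauchy filters rather than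
    sequences.\<close>
  have "cauchy_filter (filtermap (\<lambda>g. T g x) at_top)"
    unfolding cauchy_filter_metric_filtermap
  proof (intro allI impI)
    fix e :: real
    assume "0 < e"
    then obtain k where "\<forall>g\<ge>k. \<forall>h\<ge>k. dist (T g x) (T h x) < e"
      using tail by blast
    then show "\<exists>P. eventually P at_top \<and> (\<forall>g h. P g \<and> P h \<longrightarrow> dist (T g x) (T h x) < e)"
      by (intro exI[of _ "\<lambda>g. k \<le> g"]) (auto simp: eventually_ge_at_top)
  qed
  then have "\<exists>p. filtermap (\<lambda>g. T g x) at_top \<le> nhds p"
    by (rule cauchy_filter_complete_converges[OF _ complete_UNIV]) (simp_all add: filtermap_bot_iff)
  then obtain p where "filtermap (\<lambda>g. T g x) at_top \<le> nhds p" ..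
  then show ?thesis
    by (intro that) (simp add: filterlim_def)
qed

lemma jointly_P2_limit_fixed:
  assumes "jointly_P2 T" and lim: "((\<lambda>g. T g x) \<longlongrightarrow> p) at_top"
  shows "p \<in> common_Fix T"
proof -
  have "T m p = p" if m: "0 < m" for m
  proof -
    have inv0: "((\<lambda>g. 1 / g) \<longlongrightarrow> 0) (at_top :: real filter)"
      by (simp add: tendsto_divide_0[OF tendsto_const] filterlim_at_top_imp_at_infinity filterlim_ident)
    \<comment> \<open>Both sides stay unsimplified to match the termwise limits. The factor
      \<open>1 / g\<close> tends to 0 while its bracket converges, so only twice the squared
      distance from \<open>p\<close> to \<open>T m p\<close>, over \<open>m\<close>,
      survives.\<close>
    have "1 / m * ((dist p (T m p))\<^sup>2 + (dist p (T m p))\<^sup>2 - (dist p p)\<^sup>2)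
      \<le> 0 * ((dist x (T m p))\<^sup>2 - (dist x p)\<^sup>2 - (dist p (T m p))\<^sup>2)"
    proof (rule tendsto_le[OF trivial_limit_at_top_linorder])
      show "\<forall>\<^sub>F g in at_top.
          1 / m * ((dist (T g x) (T m p))\<^sup>2 + (dist p (T m p))\<^sup>2 - (dist p (T g x))\<^sup>2)
          \<le> 1 / g * ((dist x (T m p))\<^sup>2 - (dist x (T g x))\<^sup>2 - (dist (T g x) (T m p))\<^sup>2)"
        using eventually_gt_at_top[of 0]
        by eventually_elim (rule jointly_P2_D[OF assms(1) _ m])
    qed (intro tendsto_intros lim inv0)+
    then have "(dist p (T m p))\<^sup>2 \<le> 0"
      using m by (simp add: field_simps)
    then show ?thesis
      by simp
  qed
  then show ?thesis
    by (simp add: common_Fix_def Fix_def)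
qed

lemma jointly_P2_limit_closest:
  assumes "jointly_P2 T" and lim: "((\<lambda>g. T g x) \<longlongrightarrow> p) at_top" and q: "q \<in> common_Fix T"
  shows "(dist x p)\<^sup>2 + (dist p q)\<^sup>2 \<le> (dist x q)\<^sup>2"
proof (rule tendsto_upperbound[OF _ _ trivial_limit_at_top_linorder])
  show "((\<lambda>g. (dist x (T g x))\<^sup>2 + (dist (T g x) q)\<^sup>2) \<longlongrightarrow> (dist x p)\<^sup>2 + (dist p q)\<^sup>2) at_top"
    by (intro tendsto_intros lim)
  show "\<forall>\<^sub>F g in at_top. (dist x (T g x))\<^sup>2 + (dist (T g x) q)\<^sup>2 \<le> (dist x q)\<^sup>2"
    using eventually_gt_at_top[of 0]
  proof eventually_elim
    case (elim g)
    \<comment> \<open>With a fixed point \<open>q\<close> in the second slot, the left side of the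
      mutual condition vanishes; the index 1 is an arbitrary positive choice.\<close>
    have "T 1 q = q"
      using q by (simp add: common_Fix_def Fix_def)
    then have "0 \<le> 1 / g * ((dist x q)\<^sup>2 - (dist x (T g x))\<^sup>2 - (dist (T g x) q)\<^sup>2)"
      using jointly_P2_D[OF assms(1) elim, of 1 x q] by (simp add: dist_commute)
    then show ?case
      using elim by (simp add: zero_le_divide_iff)
  qed
qed

theorem theorem5p3:
  fixes T :: "real \<Rightarrow> 'a \<Rightarrow> 'a::{cat0_space, complete_space}"
    and x :: 'a and b :: real and l :: "nat \<Rightarrow> real"
  assumes "jointly_P2 T"
    and "b > 0"
    and "\<And>n. l n > 0"
    and "filterlim l at_top sequentially"
    and "\<And>n. dist x (T (l n) x) \<le> b"
  shows "common_Fix T \<noteq> {} \<and>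
    continuous_on {0<..} (\<lambda>g. T g x) \<and>
    (\<exists>p. closest_points x (common_Fix T) = {p} \<and> ((\<lambda>g. T g x) \<longlongrightarrow> p) at_top)"
proof -
  have bound: "dist x (T g x) \<le> b" if "0 < g" for g
    by (rule jointly_P2_bounded[OF assms(1,4) _ _ that]) (simp_all add: assms(5))
  obtain p where p: "((\<lambda>g. T g x) \<longlongrightarrow> p) at_top"
    using jointly_P2_convergent[OF assms(1) bound] by blast
  have pF: "p \<in> common_Fix T"
    by (rule jointly_P2_limit_fixed[OF assms(1) p])
  \<comment> \<open>Dropping the term in \<open>dist p q\<close> shows that \<open>p\<close> is
    closest; keeping it forces every closest point to equal \<open>p\<close>.\<close>
  have proj: "(dist x p)\<^sup>2 + (dist p q)\<^sup>2 \<le> (dist x q)\<^sup>2" if "q \<in> common_Fix T" for q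
    by (rule jointly_P2_limit_closest[OF assms(1) p that])
  have "closest_points x (common_Fix T) = {p}"
  proof (intro equalityI subsetI)
    fix q
    assume "q \<in> closest_points x (common_Fix T)"
    then have q: "q \<in> common_Fix T" "dist x q \<le> dist x p"
      using pF by (auto simp: closest_points_def)
    have "(dist x q)\<^sup>2 \<le> (dist x p)\<^sup>2"
      using q(2) by (simp add: power_mono)
    then have "(dist p q)\<^sup>2 \<le> 0"
      using proj[OF q(1)] by linarith
    then show "q \<in> {p}"
      by simp
  next
    fix q
    assume "q \<in> {p}"
    moreover have "dist x p \<le> dist x r" if "r \<in> common_Fix T" for r
    proof (rule power2_le_imp_le)
      show "(dist x p)\<^sup>2 \<le> (dist x r)\<^sup>2"
        using proj[OF that] zero_le_power2[of "dist p r"] by linarith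
    qed simp
    ultimately show "q \<in> closest_points x (common_Fix T)"
      using pF by (simp add: closest_points_def)
  qed
  then show ?thesis
    using pF p jointly_P2_continuous[OF assms(1) bound] by blast
qed

end
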